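(* Let $K$ be a compact and connected subgroup of $U(N)$ with Lie algebra $\mathfrak{k}$, and let $\mathfrak{t}$ be a torus algebra of $\mathfrak{k}$. Let $A \in \mathbb{C}^{N\times N}$, $A \neq 0$. Then the orbit $\mathcal{O}_K(A)$ is weakly rotationally symmetric if and only if (a) there exists $\Omega \in \mathfrak{k}$ such that $A$ is an eigenvector of the operator $\mathrm{ad}_\Omega$ to a non-zero eigenvalue; or equivalently, if and only if (b) there exist $U \in K$ and $\Delta \in \mathfrak{t}$ such that $UAU^\dagger$ is an eigenvector of the operator $\mathrm{ad}_\Delta$ to a non-zero eigenvalue.
   Context: $U(N)$ denotes the group of unitary $N\times N$ complex matrices and $\mathfrak{u}(N)$ its Lie algebra of skew-Hermitian matrices. For a compact connected subgroup $K\subset U(N)$ and $A\in\mathbb{C}^{N\times N}$, the $K$-orbit is $\mathcal{O}_K(A)=\{UAU^\dagger \mid U\in K\}$. The orbit is called weakly rotationally symmetric if $e^{i\varphi}\mathcal{O}_K(A)=\mathcal{O}_K(A)$ for all $\varphi\in\mathbb{R}$. For $\Omega\in\mathfrak{k}$, $\mathrm{ad}_\Omega:\mathbb{C}^{N\times N}\to\mathbb{C}^{N\times N}$, $X\mapsto \Omega X - X\Omega$. A torus algebra of $\mathfrak{k}$ is a maximal Abelian subalgebra of $\mathfrak{k}$. *)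

theory Defs
  imports "HOL-Analysis.Analysis"
begin

text \<open>Complex N x N matrices are represented as complex^'n^'n with 'n a finite type, N = CARD('n).\<close>

definition cadj :: "complex^'n^'n \<Rightarrow> complex^'n^'n" where
  "cadj A = (\<chi> i j. cnj (A $ j $ i))"

definition cscale :: "complex \<Rightarrow> complex^'n^'n \<Rightarrow> complex^'n^'n" where
  "cscale c A = (\<chi> i j. c * A $ i $ j)"

definition unitary_group :: "(complex^'n^'n) set" where
  "unitary_group = {U. U ** cadj U = mat 1 \<and> cadj U ** U = mat 1}"

text \<open>Matrix exponential, defined by its power series entrywise.\<close>
definition mexp :: "complex^'n^'n \<Rightarrow> complex^'n^'n" where
  "mexp A = (\<chi> i j. (\<Sum>k. ((((**) A) ^^ k) (mat 1)) $ i $ j / of_nat (fact k)))"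

definition is_subgroup_U :: "(complex^'n^'n) set \<Rightarrow> bool" where
  "is_subgroup_U K \<longleftrightarrow> K \<subseteq> unitary_group \<and> mat 1 \<in> K \<and>
     (\<forall>U\<in>K. \<forall>V\<in>K. U ** V \<in> K) \<and> (\<forall>U\<in>K. cadj U \<in> K)"

text \<open>Lie algebra of a (closed) subgroup K of U(N): all \<Omega> with exp(t\<Omega>) in K for all real t.
  These are automatically skew-Hermitian.\<close>
definition lie_alg :: "(complex^'n^'n) set \<Rightarrow> (complex^'n^'n) set" where
  "lie_alg K = {\<Omega>. \<forall>t::real. mexp (t *\<^sub>R \<Omega>) \<in> K}"

definition ad :: "complex^'n^'n \<Rightarrow> complex^'n^'n \<Rightarrow> complex^'n^'n" where
  "ad \<Omega> X = \<Omega> ** X - X ** \<Omega>"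

text \<open>A real Lie subalgebra of the real Lie algebra L that is Abelian.\<close>
definition abelian_subalg :: "(complex^'n^'n) set \<Rightarrow> (complex^'n^'n) set \<Rightarrow> bool" where
  "abelian_subalg L T \<longleftrightarrow> T \<subseteq> L \<and> subspace T \<and> (\<forall>X\<in>T. \<forall>Y\<in>T. X ** Y = Y ** X)"

text \<open>Torus algebra: maximal Abelian subalgebra.\<close>
definition torus_algebra :: "(complex^'n^'n) set \<Rightarrow> (complex^'n^'n) set \<Rightarrow> bool" where
  "torus_algebra L T \<longleftrightarrow> abelian_subalg L T \<and>
     (\<forall>T'. abelian_subalg L T' \<and> T \<subseteq> T' \<longrightarrow> T' = T)"

definition orbit :: "(complex^'n^'n) set \<Rightarrow> complex^'n^'n \<Rightarrow> (complex^'n^'n) set" where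
  "orbit K A = {U ** A ** cadj U | U. U \<in> K}"

definition weakly_rot_sym :: "(complex^'n^'n) set \<Rightarrow> complex^'n^'n \<Rightarrow> bool" where
  "weakly_rot_sym K A \<longleftrightarrow> (\<forall>\<phi>::real. cscale (cis \<phi>) ` orbit K A = orbit K A)"

text \<open>X is an eigenvector of ad_\<Omega> to a non-zero eigenvalue.\<close>
definition ad_eigvec_nonzero :: "complex^'n^'n \<Rightarrow> complex^'n^'n \<Rightarrow> bool" where
  "ad_eigvec_nonzero \<Omega> X \<longleftrightarrow> X \<noteq> 0 \<and> (\<exists>c::complex. c \<noteq> 0 \<and> ad \<Omega> X = cscale c X)"

end

theory Submission
  imports Defs
begin

text \<open>
  If \<open>h\<^sub>n \<in> K\<close>, \<open>e\<^sub>n\<close> tends to \<open>0\<close> from above and \<open>(h\<^sub>n - 1) / e\<^sub>n\<close> tends to \<open>Y\<close>, then the powers of \<open>h\<^sub>n\<close> with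
  exponent \<open>\<lfloor>t / e\<^sub>n\<rfloor>\<close> tend to \<open>exp (t Y)\<close>, so \<open>Y\<close> lies in the Lie algebra of the compact group \<open>K\<close>. It follows
  that a closed subgroup \<open>H\<close> of \<open>K\<close> whose Lie algebra is all of that of \<open>K\<close> is open in \<open>K\<close>. Otherwise some
  \<open>x\<^sub>n \<in> K - H\<close> converge to a point of \<open>H\<close>; let \<open>h\<^sub>n\<close> be an element of the coset \<open>H x\<^sub>n\<close> closest to \<open>1\<close>. Along a
  subsequence \<open>(h\<^sub>n - 1) / \<parallel>h\<^sub>n - 1\<parallel>\<close> tends to some \<open>Y\<close> in the Lie algebra of \<open>K\<close>. If \<open>Y\<close> belonged to that of
  \<open>H\<close>, then \<open>exp (- \<parallel>h\<^sub>n - 1\<parallel> Y) h\<^sub>n\<close> would be an element of the same coset that is closer to \<open>1\<close>.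

  Let \<open>G\<close> be the stabilizer in \<open>K\<close> of the line \<open>\<complex> A\<close>, and \<open>H\<close> the stabilizer of \<open>A\<close> itself. If the orbit is
  rotationally symmetric, then \<open>G\<close> multiplies \<open>A\<close> by arbitrarily small phases, so \<open>H\<close> is not open in \<open>G\<close> and some
  \<open>\<Omega>\<close> is in the Lie algebra of \<open>G\<close> but not in that of \<open>H\<close>, that is, \<open>[\<Omega>, A] = c A\<close> with \<open>c \<noteq> 0\<close>. Conversely
  this equation integrates to \<open>exp (t \<Omega>) A exp (- t \<Omega>) = e\<^bsup>ct\<^esup> A\<close>, where \<open>c\<close> is imaginary because \<open>[\<Omega>, -]\<close> is
  skew-symmetric.

  To conjugate \<open>\<Omega>\<close> into \<open>T\<close>, maximise \<open>\<langle>U \<Omega> U\<^sup>\<dagger>, Z\<rangle>\<close> over \<open>U \<in> K\<close> (Hunt): at a maximum \<open>U \<Omega> U\<^sup>\<dagger>\<close> commutes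
  with \<open>Z\<close>. Doing this successively for a basis of \<open>T\<close>, each time inside the centraliser of the
  preceding basis elements, gives a conjugate of \<open>\<Omega>\<close> that commutes with \<open>T\<close>, hence lies in \<open>T\<close> by maximality.
\<close>

subsection \<open>Derivatives along a real parameter and the exponential in Banach algebras\<close>

lemma has_vector_derivative_iff_tendsto:
  "(f has_vector_derivative D) (at x) \<longleftrightarrow> ((\<lambda>t. (f t - f x) /\<^sub>R (t - x)) \<longlongrightarrow> D) (at x)"
proof -
  have "norm (f t - f x - (t - x) *\<^sub>R D) / norm (t - x) = norm ((f t - f x) /\<^sub>R (t - x) - D)"
    if "t \<noteq> x" for t
  proof -
    have "(f t - f x) /\<^sub>R (t - x) - D = (f t - f x - (t - x) *\<^sub>R D) /\<^sub>R (t - x)"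
      using that by (simp add: scaleR_diff_right)
    then show ?thesis by (simp add: divide_inverse mult.commute)
  qed
  then have "((\<lambda>t. norm (f t - f x - (t - x) *\<^sub>R D) / norm (t - x)) \<longlongrightarrow> 0) (at x)
      \<longleftrightarrow> ((\<lambda>t. norm ((f t - f x) /\<^sub>R (t - x) - D)) \<longlongrightarrow> 0) (at x)"
    by (intro tendsto_cong) (simp add: eventually_at_filter)
  then show ?thesis
    by (simp add: has_vector_derivative_def has_derivative_iff_norm bounded_linear_scaleR_left
        tendsto_norm_zero_iff LIM_zero_iff)
qed

lemma has_vector_derivative_imp_LIMSEQ:
  assumes "(f has_vector_derivative D) (at x)" and e: "\<And>n. e n \<noteq> 0" "e \<longlonglongrightarrow> 0"
  shows "(\<lambda>n. (f (x + e n) - f x) /\<^sub>R e n) \<longlonglongrightarrow> D"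
proof -
  have "(\<lambda>n. x + e n) \<longlonglongrightarrow> x" using tendsto_add[OF tendsto_const[of x] e(2)] by simp
  then have "filterlim (\<lambda>n. x + e n) (at x) sequentially"
    using e(1) by (simp add: filterlim_at)
  from filterlim_compose[OF assms(1)[unfolded has_vector_derivative_iff_tendsto] this]
  show ?thesis by simp
qed

lemma subspace_has_vector_derivative:
  fixes S :: "'a::euclidean_space set"
  assumes "subspace S" "\<And>t. f t \<in> S" "(f has_vector_derivative D) (at x)"
  shows "D \<in> S"
proof (rule Lim_in_closed_set)
  show "((\<lambda>t. (f t - f x) /\<^sub>R (t - x)) \<longlongrightarrow> D) (at x)"
    using assms(3) by (simp add: has_vector_derivative_iff_tendsto)
qed (use assms in \<open>auto simp: closed_subspace subspace_diff subspace_scale\<close>)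

lemma norm_power_diff_le:
  fixes a b :: "'a::real_normed_algebra_1"
  assumes "norm a \<le> M" "norm b \<le> M" "1 \<le> M"
  shows "norm (a ^ k - b ^ k) \<le> real k * norm (a - b) * M ^ k"
proof (induction k)
  case (Suc k)
  have "a ^ Suc k - b ^ Suc k = a ^ k * (a - b) + (a ^ k - b ^ k) * b"
    by (simp add: power_Suc2 algebra_simps del: power_Suc)
  then have "norm (a ^ Suc k - b ^ Suc k) \<le> norm (a ^ k) * norm (a - b) + norm (a ^ k - b ^ k) * norm b"
    by (metis add_mono norm_mult_ineq norm_triangle_le)
  also have "\<dots> \<le> M ^ Suc k * norm (a - b) + (real k * norm (a - b) * M ^ k) * M"
  proof (intro add_mono mult_mono Suc.IH assms mult_nonneg_nonneg)
    have "norm (a ^ k) \<le> M ^ k"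
      by (meson assms(1) norm_ge_zero norm_power_ineq order_trans power_mono)
    also have "\<dots> \<le> M ^ Suc k" using assms(3) by (simp add: power_increasing)
    finally show "norm (a ^ k) \<le> M ^ Suc k" .
  qed (use assms in auto)
  finally show ?case by (simp add: algebra_simps)
qed simp

lemma exp_scaleR_of_nat:
  fixes X :: "'a::{real_normed_algebra_1,banach}"
  shows "exp (real k *\<^sub>R X) = exp X ^ k"
proof (induction k)
  case (Suc k)
  have "exp (X + real k *\<^sub>R X) = exp X * exp (real k *\<^sub>R X)"
    by (rule exp_add_commuting) simp
  then show ?case using Suc by (simp add: scaleR_left_distrib)
qed simp

lemma exp_intertwine:
  fixes X Y A :: "'a::{real_normed_algebra_1,banach}"
  assumes "X * A = A * Y"
  shows "exp X * A = A * exp Y"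
proof -
  have "X ^ k * A = A * Y ^ k" for k
  proof (induction k)
    case (Suc k)
    then show ?case by (metis assms mult.assoc power_Suc)
  qed simp
  moreover have "(\<lambda>k. (X ^ k /\<^sub>R fact k) * A) sums (exp X * A)"
    by (intro sums_mult2 exp_converges)
  moreover have "(\<lambda>k. A * (Y ^ k /\<^sub>R fact k)) sums (A * exp Y)"
    by (intro sums_mult exp_converges)
  ultimately show ?thesis by (simp add: sums_unique2)
qed

lemma exp_bounded_linear_hom:
  fixes f :: "'a::{real_normed_algebra_1,banach} \<Rightarrow> 'b::{real_normed_algebra_1,banach}"
  assumes "bounded_linear f" and one: "f 1 = 1" and mult: "\<And>x y. f (x * y) = f x * f y"
  shows "f (exp x) = exp (f x)"
proof -
  interpret bounded_linear f by fact
  have "f (x ^ k) = f x ^ k" for k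
    by (induction k) (simp_all add: one mult)
  then have "(\<lambda>k. f x ^ k /\<^sub>R fact k) sums f (exp x)"
    using sums[OF exp_converges[of x]] by (simp add: scaleR)
  then show ?thesis using exp_converges sums_unique2 by blast
qed

lemma exp_scaleR_has_vector_derivative_0:
  fixes X :: "'a::{real_normed_algebra_1,banach}"
  shows "((\<lambda>t. exp (t *\<^sub>R X)) has_vector_derivative X) (at 0)"
  using exp_scaleR_has_vector_derivative_right[of X 0 UNIV] by simp

lemma tendsto_exp_scaleR:
  fixes X :: "'a::{real_normed_algebra_1,banach}"
  assumes "(f \<longlongrightarrow> t) F"
  shows "((\<lambda>x. exp (f x *\<^sub>R X)) \<longlongrightarrow> exp (t *\<^sub>R X)) F"
proof -
  have "isCont (\<lambda>t. exp (t *\<^sub>R X)) t"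
    using exp_scaleR_has_vector_derivative_right has_vector_derivative_continuous by blast
  from isCont_tendsto_compose[OF this assms] show ?thesis .
qed

lemma power_diff_tendsto_0:
  fixes a b :: "nat \<Rightarrow> 'a::real_normed_algebra_1"
  assumes e: "\<And>n. 0 < e n" and C: "0 \<le> C"
    and a: "\<And>n. norm (a n) \<le> exp (e n * C)" and b: "\<And>n. norm (b n) \<le> exp (e n * C)"
    and diff: "(\<lambda>n. (a n - b n) /\<^sub>R e n) \<longlonglongrightarrow> 0"
    and k: "(\<lambda>n. real (k n) * e n) \<longlonglongrightarrow> t"
  shows "(\<lambda>n. a n ^ k n - b n ^ k n) \<longlonglongrightarrow> 0"
proof (rule Lim_null_comparison)
  let ?bound = "\<lambda>n. (real (k n) * e n) * norm ((a n - b n) /\<^sub>R e n) * exp ((real (k n) * e n) * C)"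
  have "norm (a n ^ k n - b n ^ k n) \<le> ?bound n" for n
  proof -
    have "norm (a n ^ k n - b n ^ k n) \<le> real (k n) * norm (a n - b n) * exp (e n * C) ^ k n"
      using C e[of n] by (intro norm_power_diff_le a b) simp
    also have "\<dots> = ?bound n"
      using e[of n] by (simp add: mult_ac flip: exp_of_nat_mult)
    finally show ?thesis .
  qed
  then show "\<forall>\<^sub>F n in sequentially. norm (a n ^ k n - b n ^ k n) \<le> ?bound n" by simp
  show "?bound \<longlonglongrightarrow> 0"
    by (rule tendsto_eq_intros k diff refl)+ simp
qed

lemma norm_le_exp_if_difference_quotient:
  fixes h :: "'a::real_normed_algebra_1"
  assumes "0 < e" "norm ((h - 1) /\<^sub>R e) \<le> C"
  shows "norm h \<le> exp (e * C)"
proof -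
  have "inverse e * norm (h - 1) \<le> C" using assms by simp
  then have "norm (h - 1) \<le> e * C" using \<open>0 < e\<close> by (simp add: field_simps)
  then have "norm h \<le> 1 + e * C" using norm_triangle_ineq[of 1 "h - 1"] by simp
  also have "\<dots> \<le> exp (e * C)" by (rule exp_ge_add_one_self)
  finally show ?thesis .
qed

lemma power_tendsto_exp:
  fixes h :: "nat \<Rightarrow> 'a::{real_normed_algebra_1,banach}"
  assumes e_pos: "\<And>n. 0 < e n" and e_lim: "e \<longlonglongrightarrow> 0"
    and tangent: "(\<lambda>n. (h n - 1) /\<^sub>R e n) \<longlonglongrightarrow> Y"
    and k: "(\<lambda>n. real (k n) * e n) \<longlonglongrightarrow> t"
  shows "(\<lambda>n. h n ^ k n) \<longlonglongrightarrow> exp (t *\<^sub>R Y)"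
proof -
  obtain C where C: "norm ((h n - 1) /\<^sub>R e n) \<le> C" for n
    using convergent_imp_Bseq[OF convergentI[OF tangent]] unfolding Bseq_def by blast
  have Y_le: "norm Y \<le> C"
    by (rule Lim_bounded[OF tendsto_norm[OF tangent]]) (use C in auto)
  have power_diff: "(\<lambda>n. h n ^ k n - exp (e n *\<^sub>R Y) ^ k n) \<longlonglongrightarrow> 0"
  proof (rule power_diff_tendsto_0[OF e_pos _ _ _ _ k])
    show "0 \<le> C" using Y_le norm_ge_zero order_trans by blast
    show "norm (h n) \<le> exp (e n * C)" for n
      by (rule norm_le_exp_if_difference_quotient[OF e_pos C])
    show "norm (exp (e n *\<^sub>R Y)) \<le> exp (e n * C)" for n
    proof -
      have "norm (exp (e n *\<^sub>R Y)) \<le> exp (norm (e n *\<^sub>R Y))" by (rule norm_exp)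
      also have "\<dots> \<le> exp (e n * C)" using Y_le e_pos[of n] by simp
      finally show ?thesis .
    qed
    have "(\<lambda>n. (exp (e n *\<^sub>R Y) - 1) /\<^sub>R e n) \<longlonglongrightarrow> Y"
      using has_vector_derivative_imp_LIMSEQ[OF exp_scaleR_has_vector_derivative_0 _ e_lim] e_pos
      by (simp add: less_imp_neq[THEN not_sym])
    from tendsto_diff[OF tangent this]
    show "(\<lambda>n. (h n - exp (e n *\<^sub>R Y)) /\<^sub>R e n) \<longlonglongrightarrow> 0"
      by (simp flip: scaleR_diff_right)
  qed
  have "(\<lambda>n. exp ((real (k n) * e n) *\<^sub>R Y)) \<longlonglongrightarrow> exp (t *\<^sub>R Y)"
    by (rule tendsto_exp_scaleR[OF k])
  from tendsto_add[OF power_diff this] show ?thesis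
    by (simp flip: exp_scaleR_of_nat)
qed

subsection \<open>Square matrices as a Banach algebra\<close>

lemma bounded_bilinear_matrix_mult:
  "bounded_bilinear ((**) :: 'a::{euclidean_space,real_algebra_1}^'n^'m \<Rightarrow> 'a^'p^'n \<Rightarrow> 'a^'p^'m)"
  unfolding bilinear_conv_bounded_bilinear[symmetric] bilinear_def
  by (auto intro!: linearI simp: matrix_matrix_mult_def vec_eq_iff sum.distrib distrib_left distrib_right
      scaleR_sum_right)

interpretation matrix_mult: bounded_bilinear
  "(**) :: 'a::{euclidean_space,real_algebra_1}^'n^'m \<Rightarrow> 'a^'p^'n \<Rightarrow> 'a^'p^'m"
  by (rule bounded_bilinear_matrix_mult)

lemma norm_axis: "norm (axis i x) = norm x"
  by (simp add: norm_vec_def L2_set_def axis_def if_distrib[where f=norm]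
      if_distrib[where f="\<lambda>y. y\<^sup>2"] cong: if_cong)

lemma norm_matrix_le_onorm:
  fixes A :: "'a::{euclidean_space,real_normed_algebra_1}^'n^'m"
  shows "norm A \<le> onorm ((*v) A) * (real CARD('m) * real CARD('n))"
proof -
  have component_le: "norm (A $ i $ j) \<le> onorm ((*v) A)" for i j
  proof -
    have "norm (A $ i $ j) = norm ((A *v axis j 1) $ i)"
      by (simp add: matrix_vector_mult_def axis_def if_distrib[where f="(*) _"] cong: if_cong)
    also have "\<dots> \<le> norm (A *v axis j 1)" by (rule Finite_Cartesian_Product.norm_nth_le)
    also have "\<dots> \<le> onorm ((*v) A) * norm (axis j (1::'a))" by (rule onorm) simp
    finally show ?thesis by (simp add: norm_axis)
  qed
  have "norm A \<le> (\<Sum>i\<in>UNIV. norm (A $ i))"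
    unfolding norm_vec_def by (rule L2_set_le_sum) simp
  also have "\<dots> \<le> (\<Sum>i\<in>UNIV. \<Sum>j\<in>UNIV. norm (A $ i $ j))"
    unfolding norm_vec_def[of "_ $ _"] by (intro sum_mono L2_set_le_sum) simp
  also have "\<dots> \<le> (\<Sum>i::'m\<in>UNIV. \<Sum>j::'n\<in>UNIV. onorm ((*v) A))"
    by (intro sum_mono component_le)
  finally show ?thesis by (simp add: algebra_simps)
qed

lemma onorm_matrix_eq_0_iff: "onorm ((*v) A) = 0 \<longleftrightarrow> A = 0"
  for A :: "'a::{euclidean_space,real_normed_algebra_1}^'n^'m"
proof
  assume "onorm ((*v) A) = 0"
  then show "A = 0" using norm_matrix_le_onorm[of A] by simp
qed (simp add: onorm_eq_0)

lemma onorm_mat_1: "onorm ((*v) (mat 1 :: 'a::{euclidean_space,real_algebra_1}^'n^'n)) = 1"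
proof -
  have "(*v) (mat 1 :: 'a^'n^'n) = (\<lambda>x. x)" by auto
  then show ?thesis by (simp add: onorm_id)
qed

lemma onorm_matrix_add_le: "onorm ((*v) (A + B)) \<le> onorm ((*v) A) + onorm ((*v) B)"
  for A B :: "'a::{euclidean_space,real_algebra_1}^'n^'m"
proof -
  have "(*v) (A + B) = (\<lambda>x. A *v x + B *v x)" by (auto simp: matrix_vector_mult_add_rdistrib)
  then show ?thesis by (simp add: onorm_triangle)
qed

lemma onorm_scaleR_matrix: "onorm ((*v) (r *\<^sub>R A)) = \<bar>r\<bar> * onorm ((*v) A)"
  for A :: "'a::{euclidean_space,real_algebra_1}^'n^'m"
proof -
  have "(*v) (r *\<^sub>R A) = (\<lambda>x. r *\<^sub>R (A *v x))"
    by (auto simp: matrix_vector_mult_def vec_eq_iff scaleR_sum_right)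
  then show ?thesis by (simp add: onorm_scaleR)
qed

lemma onorm_matrix_mult_le: "onorm ((*v) (A ** B)) \<le> onorm ((*v) A) * onorm ((*v) B)"
  for A :: "'a::{euclidean_space,real_algebra_1}^'n^'m" and B :: "'a^'p^'n"
proof -
  have "(*v) (A ** B) = (*v) A \<circ> (*v) B" by (auto simp: matrix_vector_mul_assoc)
  then show ?thesis by (simp add: onorm_compose)
qed

text \<open>A copy of the type of matrices is needed because the library's \<open>(*)\<close> and \<open>norm\<close> on \<open>'a^'n^'n\<close>
  are the componentwise product and the Euclidean norm.\<close>

typedef ('a, 'n::finite) sqmat = "UNIV :: ('a^'n^'n) set"
  morphisms mat_of_sqmat sqmat_of_mat by simp

setup_lifting type_definition_sqmat

instantiation sqmat :: ("{euclidean_space,real_normed_algebra_1}", finite) real_normed_algebra_1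
begin

lift_definition zero_sqmat :: "('a, 'b) sqmat" is 0 .
lift_definition one_sqmat :: "('a, 'b) sqmat" is "mat 1" .
lift_definition plus_sqmat :: "('a, 'b) sqmat \<Rightarrow> ('a, 'b) sqmat \<Rightarrow> ('a, 'b) sqmat" is "(+)" .
lift_definition minus_sqmat :: "('a, 'b) sqmat \<Rightarrow> ('a, 'b) sqmat \<Rightarrow> ('a, 'b) sqmat" is "(-)" .
lift_definition uminus_sqmat :: "('a, 'b) sqmat \<Rightarrow> ('a, 'b) sqmat" is "uminus" .
lift_definition times_sqmat :: "('a, 'b) sqmat \<Rightarrow> ('a, 'b) sqmat \<Rightarrow> ('a, 'b) sqmat" is "(**)" .
lift_definition scaleR_sqmat :: "real \<Rightarrow> ('a, 'b) sqmat \<Rightarrow> ('a, 'b) sqmat" is "(*\<^sub>R)" .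
lift_definition norm_sqmat :: "('a, 'b) sqmat \<Rightarrow> real" is "\<lambda>A. onorm ((*v) A)" .
definition dist_sqmat :: "('a, 'b) sqmat \<Rightarrow> ('a, 'b) sqmat \<Rightarrow> real"
  where "dist_sqmat x y = norm (x - y)"
definition sgn_sqmat :: "('a, 'b) sqmat \<Rightarrow> ('a, 'b) sqmat"
  where "sgn_sqmat x = inverse (norm x) *\<^sub>R x"
definition uniformity_sqmat :: "(('a, 'b) sqmat \<times> ('a, 'b) sqmat) filter"
  where "uniformity_sqmat = (INF e\<in>{0 <..}. principal {(x, y). dist x y < e})"
definition open_sqmat :: "('a, 'b) sqmat set \<Rightarrow> bool"
  where "open_sqmat U \<longleftrightarrow> (\<forall>x\<in>U. eventually (\<lambda>(x', y). x' = x \<longrightarrow> y \<in> U) uniformity)"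

instance
proof
  fix x y z :: "('a, 'b) sqmat" and a b :: real
  show "x + y + z = x + (y + z)" "x + y = y + x" "0 + x = x" "- x + x = 0" "x - y = x + - y"
    by (transfer; simp)+
  show "a *\<^sub>R (x + y) = a *\<^sub>R x + a *\<^sub>R y" "(a + b) *\<^sub>R x = a *\<^sub>R x + b *\<^sub>R x"
    "a *\<^sub>R b *\<^sub>R x = (a * b) *\<^sub>R x" "1 *\<^sub>R x = x"
    by (transfer; simp add: algebra_simps)+
  show "x * y * z = x * (y * z)" by transfer (simp add: matrix_mul_assoc)
  show "(x + y) * z = x * z + y * z" "x * (y + z) = x * y + x * z"
    by (transfer; simp add: matrix_mult.add_left matrix_mult.add_right)+
  show "a *\<^sub>R x * y = a *\<^sub>R (x * y)" "x * a *\<^sub>R y = a *\<^sub>R (x * y)"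
    by (transfer; simp add: matrix_mult.scaleR_left matrix_mult.scaleR_right)+
  show "1 * x = x" "x * 1 = x" by (transfer; simp)+
  show "0 \<noteq> (1 :: ('a, 'b) sqmat)" by transfer (simp add: vec_eq_iff mat_def)
  show "norm (1 :: ('a, 'b) sqmat) = 1" by transfer (rule onorm_mat_1)
  show "norm x = 0 \<longleftrightarrow> x = 0" by transfer (rule onorm_matrix_eq_0_iff)
  show "norm (x + y) \<le> norm x + norm y" by transfer (rule onorm_matrix_add_le)
  show "norm (a *\<^sub>R x) = \<bar>a\<bar> * norm x" by transfer (rule onorm_scaleR_matrix)
  show "norm (x * y) \<le> norm x * norm y" by transfer (rule onorm_matrix_mult_le)
  show "dist x y = norm (x - y)" by (rule dist_sqmat_def)
qed (rule sgn_sqmat_def uniformity_sqmat_def open_sqmat_def)+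

end

lemma bounded_linear_sqmat_of_mat:
  "bounded_linear (sqmat_of_mat :: 'a::{euclidean_space,real_normed_algebra_1}^'n^'n \<Rightarrow> ('a, 'n) sqmat)"
  unfolding linear_conv_bounded_linear[symmetric]
  by (rule linearI) (auto simp: plus_sqmat.abs_eq scaleR_sqmat.abs_eq)

lemma bounded_linear_mat_of_sqmat:
  "bounded_linear (mat_of_sqmat :: ('a::{euclidean_space,real_normed_algebra_1}, 'n::finite) sqmat \<Rightarrow> 'a^'n^'n)"
  by (rule bounded_linear_intro)
    (auto simp: plus_sqmat.rep_eq scaleR_sqmat.rep_eq norm_sqmat.rep_eq intro: norm_matrix_le_onorm)

instance sqmat :: ("{euclidean_space,real_normed_algebra_1}", finite) banach
proof
  fix X :: "nat \<Rightarrow> ('a, 'b) sqmat"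
  assume "Cauchy X"
  then have "Cauchy (\<lambda>n. mat_of_sqmat (X n))"
    by (rule bounded_linear.Cauchy[OF bounded_linear_mat_of_sqmat])
  then obtain L where "(\<lambda>n. mat_of_sqmat (X n)) \<longlonglongrightarrow> L"
    using Cauchy_convergent convergent_def by blast
  from bounded_linear.tendsto[OF bounded_linear_sqmat_of_mat this]
  show "convergent X" by (auto simp: mat_of_sqmat_inverse convergent_def)
qed

subsection \<open>The matrix exponential\<close>

lemma mat_of_sqmat_power: "mat_of_sqmat (x ^ k) = (((**) (mat_of_sqmat x)) ^^ k) (mat 1)"
  for x :: "('a::{euclidean_space,real_normed_algebra_1}, 'n::finite) sqmat"
  by (induction k) (simp_all add: one_sqmat.rep_eq times_sqmat.rep_eq)

lemma mexp_eq_exp: "mexp A = mat_of_sqmat (exp (sqmat_of_mat A))" for A :: "complex^'n^'n"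
proof -
  have "(\<lambda>k. mat_of_sqmat (sqmat_of_mat A ^ k /\<^sub>R fact k) $ i $ j)
      sums (mat_of_sqmat (exp (sqmat_of_mat A)) $ i $ j)" for i j
    by (intro bounded_linear.sums[OF bounded_linear_vec_nth] bounded_linear.sums[OF bounded_linear_mat_of_sqmat]
        exp_converges)
  moreover have "mat_of_sqmat (sqmat_of_mat A ^ k /\<^sub>R fact k) $ i $ j
      = (((**) A) ^^ k) (mat 1) $ i $ j / of_nat (fact k)" for i j k
    by (simp add: mat_of_sqmat_power sqmat_of_mat_inverse scaleR_sqmat.rep_eq
        scaleR_conv_of_real[where 'a=complex] divide_inverse mult.commute)
  ultimately show ?thesis
    by (auto simp: mexp_def vec_eq_iff sums_iff)
qed

lemma mexp_transfer [transfer_rule]: "rel_fun cr_sqmat cr_sqmat mexp exp"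
  by (auto simp: rel_fun_def cr_sqmat_def mexp_eq_exp mat_of_sqmat_inverse)

lemma mexp_zero [simp]: "mexp (0 :: complex^'n^'n) = mat 1"
  by (rule exp_zero[where 'a = "(complex, 'n) sqmat", untransferred])

lemma mexp_minus_inverse: "mexp X ** mexp (- X) = mat 1" for X :: "complex^'n^'n"
  by (rule exp_minus_inverse[where 'a = "(complex, 'n) sqmat", untransferred])

lemma mexp_add_commuting: "X ** Y = Y ** X \<Longrightarrow> mexp (X + Y) = mexp X ** mexp Y"
  for X Y :: "complex^'n^'n"
  by (rule exp_add_commuting[where 'a = "(complex, 'n) sqmat", untransferred])

lemma mexp_intertwine: "X ** A = A ** Y \<Longrightarrow> mexp X ** A = A ** mexp Y"
  for A X Y :: "complex^'n^'n"
  by (rule exp_intertwine[where 'a = "(complex, 'n) sqmat", untransferred])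

lemma mexp_has_vector_derivative_0: "((\<lambda>t. mexp (t *\<^sub>R X)) has_vector_derivative X) (at 0)"
  using bounded_linear.has_vector_derivative[OF bounded_linear_mat_of_sqmat
      exp_scaleR_has_vector_derivative_0[of "sqmat_of_mat X"]]
  by (simp add: mexp_eq_exp scaleR_sqmat.abs_eq sqmat_of_mat_inverse)

lemma matrix_power_tendsto_mexp:
  fixes h :: "nat \<Rightarrow> complex^'n^'n"
  assumes "\<And>n. 0 < e n" "e \<longlonglongrightarrow> 0" "(\<lambda>n. (h n - mat 1) /\<^sub>R e n) \<longlonglongrightarrow> Y"
    and "(\<lambda>n. real (k n) * e n) \<longlonglongrightarrow> t"
  shows "(\<lambda>n. (((**) (h n)) ^^ k n) (mat 1)) \<longlonglongrightarrow> mexp (t *\<^sub>R Y)"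
proof -
  have "(\<lambda>n. (sqmat_of_mat (h n) - 1) /\<^sub>R e n) \<longlonglongrightarrow> sqmat_of_mat Y"
    using bounded_linear.tendsto[OF bounded_linear_sqmat_of_mat assms(3)]
    by (simp add: one_sqmat_def minus_sqmat.abs_eq scaleR_sqmat.abs_eq)
  from bounded_linear.tendsto[OF bounded_linear_mat_of_sqmat
      power_tendsto_exp[OF assms(1,2) this assms(4)]]
  show ?thesis
    by (simp add: mexp_eq_exp scaleR_sqmat.abs_eq mat_of_sqmat_power sqmat_of_mat_inverse)
qed

subsection \<open>Complex multiples and adjoints\<close>

lemma bounded_bilinear_cscale: "bounded_bilinear (cscale :: complex \<Rightarrow> complex^'n^'n \<Rightarrow> complex^'n^'n)"
  unfolding bilinear_conv_bounded_bilinear[symmetric] bilinear_def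
  by (auto intro!: linearI simp: cscale_def vec_eq_iff distrib_left distrib_right)

interpretation cscale: bounded_bilinear "cscale :: complex \<Rightarrow> complex^'n^'n \<Rightarrow> complex^'n^'n"
  by (rule bounded_bilinear_cscale)

lemma cscale_matrix_mult_left: "cscale c A ** B = cscale c (A ** B)"
  by (simp add: cscale_def matrix_matrix_mult_def vec_eq_iff sum_distrib_left mult.assoc)

lemma cscale_matrix_mult_right: "A ** cscale c B = cscale c (A ** B)"
  by (simp add: cscale_def matrix_matrix_mult_def vec_eq_iff sum_distrib_left mult.left_commute)

lemma cscale_cscale: "cscale c (cscale d A) = cscale (c * d) A"
  by (simp add: cscale_def vec_eq_iff mult.assoc)

lemma cscale_one [simp]: "cscale 1 A = A"
  by (simp add: cscale_def vec_eq_iff)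

lemma cscale_eq_0_iff: "cscale c A = 0 \<longleftrightarrow> c = 0 \<or> A = 0"
  by (auto simp: cscale_def vec_eq_iff)

lemma cscale_eq_self_iff: "cscale c A = A \<longleftrightarrow> c = 1 \<or> A = 0"
  using cscale_eq_0_iff[of "c - 1" A] by (simp add: cscale.diff_left)

lemma subspace_range_cscale: "subspace (range (\<lambda>c. cscale c A))"
  by (intro linear_subspace_image bounded_linear.linear cscale.bounded_linear_left subspace_UNIV)

lemma inner_cscale_self: "cscale c A \<bullet> A = Re c * (A \<bullet> A)"
  by (simp add: inner_vec_def cscale_def inner_complex_def algebra_simps sum_distrib_left)

lemma mexp_cscale_mat_1: "mexp (cscale c (mat 1 :: complex^'n^'n)) = cscale (exp c) (mat 1)"
proof -
  let ?f = "\<lambda>z. sqmat_of_mat (cscale z (mat 1 :: complex^'n^'n))"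
  have "?f (exp c) = exp (?f c)"
  proof (rule exp_bounded_linear_hom)
    show "bounded_linear ?f"
      by (intro bounded_linear_compose[OF bounded_linear_sqmat_of_mat] cscale.bounded_linear_left)
  qed (simp_all add: one_sqmat_def times_sqmat.abs_eq cscale_matrix_mult_left cscale_cscale)
  then show ?thesis by (metis mexp_eq_exp sqmat_of_mat_inverse UNIV_I)
qed

lemma mexp_ad_eigvec:
  assumes "ad X A = cscale c A"
  shows "mexp X ** A = cscale (exp c) (A ** mexp X)"
proof -
  have "X ** A = A ** (X + cscale c (mat 1))"
    using assms by (simp add: ad_def matrix_mult.add_right cscale_matrix_mult_right algebra_simps)
  then have "mexp X ** A = A ** mexp (X + cscale c (mat 1))" by (rule mexp_intertwine)
  also have "mexp (X + cscale c (mat 1)) = mexp X ** cscale (exp c) (mat 1)"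
    by (subst mexp_add_commuting)
      (simp_all add: mexp_cscale_mat_1 cscale_matrix_mult_left cscale_matrix_mult_right)
  finally show ?thesis by (simp add: cscale_matrix_mult_right)
qed

lemma bounded_bilinear_ad: "bounded_bilinear (ad :: complex^'n^'n \<Rightarrow> complex^'n^'n \<Rightarrow> complex^'n^'n)"
  unfolding bilinear_conv_bounded_bilinear[symmetric] bilinear_def
  by (auto intro!: linearI simp: ad_def matrix_mult.add_left matrix_mult.add_right
      matrix_mult.scaleR_left matrix_mult.scaleR_right scaleR_diff_right)

interpretation ad: bounded_bilinear "ad :: complex^'n^'n \<Rightarrow> complex^'n^'n \<Rightarrow> complex^'n^'n"
  by (rule bounded_bilinear_ad)

lemma ad_commute: "ad X Y = - ad Y X"
  by (simp add: ad_def)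

lemma ad_eq_0_iff: "ad X Y = 0 \<longleftrightarrow> X ** Y = Y ** X"
  by (simp add: ad_def)

lemma bounded_linear_cadj: "bounded_linear (cadj :: complex^'n^'n \<Rightarrow> complex^'n^'n)"
  unfolding linear_conv_bounded_linear[symmetric]
  by (rule linearI) (auto simp: cadj_def vec_eq_iff)

lemma cadj_diff: "cadj (A - B) = cadj A - cadj B"
  by (simp add: cadj_def vec_eq_iff)

lemma cadj_matrix_mult: "cadj (A ** B) = cadj B ** cadj A"
  by (simp add: cadj_def matrix_matrix_mult_def vec_eq_iff mult.commute)

lemma cadj_cadj [simp]: "cadj (cadj A) = A"
  by (simp add: cadj_def vec_eq_iff)

lemma cadj_mat_1 [simp]: "cadj (mat 1) = mat 1"
  by (auto simp add: cadj_def mat_def vec_eq_iff)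

lemma inner_eq_Re_trace: "A \<bullet> B = Re (trace (A ** cadj B))" for A B :: "complex^'n^'n"
  by (simp add: inner_vec_def trace_def matrix_matrix_mult_def cadj_def inner_complex_def)

lemma inner_ad_skew:
  assumes "cadj W = - W"
  shows "ad W X \<bullet> Z = - (X \<bullet> ad W Z)"
proof -
  have cadj_ad: "cadj (ad W Z) = W ** cadj Z - cadj Z ** W"
    by (simp add: ad_def cadj_diff cadj_matrix_mult assms matrix_mult.minus_right matrix_mult.minus_left)
  have "trace (ad W X ** cadj Z) = trace (W ** (X ** cadj Z)) - trace (X ** (W ** cadj Z))"
    by (simp add: ad_def matrix_mult.diff_left trace_sub flip: matrix_mul_assoc)
  also have "trace (W ** (X ** cadj Z)) = trace (X ** (cadj Z ** W))"
    by (metis matrix_mul_assoc trace_mul_sym)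
  also have "\<dots> - trace (X ** (W ** cadj Z)) = - trace (X ** cadj (ad W Z))"
    by (simp add: cadj_ad matrix_mult.diff_right trace_sub)
  finally show ?thesis by (simp add: inner_eq_Re_trace)
qed

subsection \<open>Conjugation by unitary matrices\<close>

definition Ad :: "complex^'n^'n \<Rightarrow> complex^'n^'n \<Rightarrow> complex^'n^'n" where
  "Ad U A = U ** A ** cadj U"

lemma Ad_diff: "Ad U (A - B) = Ad U A - Ad U B"
  by (simp add: Ad_def matrix_mult.diff_left matrix_mult.diff_right)

lemma Ad_scaleR: "Ad U (r *\<^sub>R A) = r *\<^sub>R Ad U A"
  by (simp add: Ad_def matrix_mult.scaleR_left matrix_mult.scaleR_right)

lemma Ad_zero [simp]: "Ad U 0 = 0"
  by (simp add: Ad_def)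

lemma Ad_cscale: "Ad U (cscale c A) = cscale c (Ad U A)"
  by (simp add: Ad_def cscale_matrix_mult_left cscale_matrix_mult_right)

lemma Ad_mat_1 [simp]: "Ad (mat 1) A = A"
  by (simp add: Ad_def)

lemma Ad_matrix_mult_left: "Ad (U ** V) A = Ad U (Ad V A)"
  by (simp add: Ad_def cadj_matrix_mult matrix_mul_assoc)

lemma continuous_on_Ad: "continuous_on S (\<lambda>U. Ad U A)"
  unfolding Ad_def
  by (intro matrix_mult.continuous_on continuous_on_const continuous_on_id
      linear_continuous_on bounded_linear_cadj)

lemma Ad_mexp_has_vector_derivative_0:
  "((\<lambda>t. Ad (mexp (t *\<^sub>R X)) Z) has_vector_derivative X ** Z + Z ** cadj X) (at 0)"
proof -
  have "((\<lambda>t. mexp (t *\<^sub>R X) ** Z) has_vector_derivative X ** Z) (at 0)"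
    by (rule bounded_linear.has_vector_derivative[OF matrix_mult.bounded_linear_left])
      (rule mexp_has_vector_derivative_0)
  moreover have "((\<lambda>t. cadj (mexp (t *\<^sub>R X))) has_vector_derivative cadj X) (at 0)"
    by (rule bounded_linear.has_vector_derivative[OF bounded_linear_cadj]) (rule mexp_has_vector_derivative_0)
  ultimately show ?thesis
    unfolding Ad_def using matrix_mult.has_vector_derivative by (fastforce simp: add.commute)
qed

lemma unitary_groupD:
  assumes "U \<in> unitary_group"
  shows "U ** cadj U = mat 1" "cadj U ** U = mat 1"
  using assms by (auto simp: unitary_group_def)

lemma norm_unitary_mult:
  fixes A U :: "complex^'n^'n"
  assumes "U \<in> unitary_group"
  shows "norm (U ** A) = norm A"
proof -
  have "trace (U ** A ** cadj (U ** A)) = trace (A ** cadj A)"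
    using unitary_groupD(2)[OF assms] trace_mul_sym[of U "A ** cadj A ** cadj U"]
    by (metis cadj_matrix_mult matrix_mul_assoc matrix_mul_rid)
  then show ?thesis by (simp add: norm_eq_sqrt_inner inner_eq_Re_trace)
qed

context
  fixes U :: "complex^'n^'n"
  assumes U: "U \<in> unitary_group"
begin

lemma Ad_cadj_cancel [simp]: "Ad (cadj U) (Ad U A) = A" "Ad U (Ad (cadj U) A) = A"
  by (simp_all add: unitary_groupD[OF U] flip: Ad_matrix_mult_left)

lemma Ad_eq_iff: "Ad U A = B \<longleftrightarrow> U ** A = B ** U"
  unfolding Ad_def by (metis unitary_groupD[OF U] matrix_mul_assoc matrix_mul_rid)

lemma Ad_matrix_mult_right: "Ad U (A ** B) = Ad U A ** Ad U B"
  unfolding Ad_def by (metis unitary_groupD(2)[OF U] matrix_mul_assoc matrix_mul_rid)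

lemma ad_Ad: "ad (Ad U X) (Ad U Y) = Ad U (ad X Y)"
  by (simp add: ad_def Ad_diff flip: Ad_matrix_mult_right)

lemma mexp_Ad: "mexp (Ad U X) = Ad U (mexp X)"
proof -
  have "U ** X = Ad U X ** U" by (simp flip: Ad_eq_iff)
  from mexp_intertwine[OF this[symmetric]] show ?thesis
    by (metis Ad_eq_iff)
qed

lemma ad_eigvec_nonzero_Ad: "ad_eigvec_nonzero (Ad U \<Omega>) (Ad U A) \<longleftrightarrow> ad_eigvec_nonzero \<Omega> A"
proof -
  have "Ad U X = Ad U Y \<longleftrightarrow> X = Y" for X Y
    by (metis Ad_cadj_cancel(1))
  from this[of A 0] this[of "ad \<Omega> A" "cscale _ A"] show ?thesis
    by (simp add: ad_eigvec_nonzero_def ad_Ad flip: Ad_cscale)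
qed

end

lemma Ad_mexp_eigvec:
  assumes "mexp X \<in> unitary_group" "ad X A = cscale c A"
  shows "Ad (mexp X) A = cscale (exp c) A"
  using mexp_ad_eigvec[OF assms(2)] by (simp add: Ad_eq_iff[OF assms(1)] cscale_matrix_mult_left)

subsection \<open>The Lie algebra of a group of unitary matrices\<close>

lemma mexp_lie_alg: "X \<in> lie_alg K \<Longrightarrow> mexp (t *\<^sub>R X) \<in> K"
  by (simp add: lie_alg_def)

lemma lie_alg_scaleR: "X \<in> lie_alg K \<Longrightarrow> c *\<^sub>R X \<in> lie_alg K"
  by (simp add: lie_alg_def)

lemma lie_alg_mono: "H \<subseteq> K \<Longrightarrow> lie_alg H \<subseteq> lie_alg K"
  by (auto simp: lie_alg_def)

locale unitary_subgroup =
  fixes K :: "(complex^'n^'n) set"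
  assumes is_subgroup_U: "is_subgroup_U K"
begin

lemma in_unitary_group: "U \<in> K \<Longrightarrow> U \<in> unitary_group"
  using is_subgroup_U by (auto simp: is_subgroup_U_def)

lemma mat_1_closed: "mat 1 \<in> K"
  using is_subgroup_U by (simp add: is_subgroup_U_def)

lemma mult_closed: "U \<in> K \<Longrightarrow> V \<in> K \<Longrightarrow> U ** V \<in> K"
  using is_subgroup_U by (simp add: is_subgroup_U_def)

lemma cadj_closed: "U \<in> K \<Longrightarrow> cadj U \<in> K"
  using is_subgroup_U by (simp add: is_subgroup_U_def)

lemma power_closed: "U \<in> K \<Longrightarrow> (((**) U) ^^ k) (mat 1) \<in> K"
  by (induction k) (simp_all add: mat_1_closed mult_closed)

lemma Ad_closed: "U \<in> K \<Longrightarrow> V \<in> K \<Longrightarrow> Ad U V \<in> K"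
  by (simp add: Ad_def mult_closed cadj_closed)

lemma Ad_in_lie_alg:
  assumes "U \<in> K" "X \<in> lie_alg K"
  shows "Ad U X \<in> lie_alg K"
proof -
  have "mexp (t *\<^sub>R Ad U X) = Ad U (mexp (t *\<^sub>R X))" for t
    by (simp add: mexp_Ad[OF in_unitary_group[OF assms(1)]] flip: Ad_scaleR)
  then show ?thesis
    using assms by (simp add: lie_alg_def Ad_closed)
qed

lemma cadj_lie_alg:
  assumes "X \<in> lie_alg K"
  shows "cadj X = - X"
proof -
  have "Ad (mexp (t *\<^sub>R X)) (mat 1) = mat 1" for t
    using in_unitary_group[OF mexp_lie_alg[OF assms]] by (simp add: Ad_eq_iff)
  then have "((\<lambda>t::real. mat 1) has_vector_derivative X + cadj X) (at 0)"
    using Ad_mexp_has_vector_derivative_0[of X "mat 1"] by simp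
  then have "X + cadj X = 0"
    using has_vector_derivative_const vector_derivative_unique_at by blast
  then show ?thesis by (simp add: eq_neg_iff_add_eq_0 add.commute)
qed

lemma Ad_mexp_lie_alg_has_vector_derivative:
  assumes "X \<in> lie_alg K"
  shows "((\<lambda>t. Ad (mexp (t *\<^sub>R X)) Z) has_vector_derivative ad X Z) (at 0)"
  using Ad_mexp_has_vector_derivative_0[of X Z]
  by (simp add: cadj_lie_alg[OF assms] ad_def matrix_mult.minus_right)

end

subsection \<open>Fixators and line stabilizers\<close>

definition fixator :: "(complex^'n^'n) set \<Rightarrow> (complex^'n^'n) set \<Rightarrow> (complex^'n^'n) set" where
  "fixator K F = {U \<in> K. \<forall>Z\<in>F. Ad U Z = Z}"

definition line_stabilizer :: "(complex^'n^'n) set \<Rightarrow> complex^'n^'n \<Rightarrow> (complex^'n^'n) set" where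
  "line_stabilizer K A = {U \<in> K. \<exists>c. Ad U A = cscale c A}"

context unitary_subgroup
begin

lemma is_subgroup_U_fixator: "is_subgroup_U (fixator K F)"
proof -
  have "Ad (cadj U) Z = Z" if "U \<in> K" "Ad U Z = Z" for U Z
    using Ad_cadj_cancel(1)[OF in_unitary_group[OF that(1)], of Z] that(2) by simp
  then show ?thesis
    using in_unitary_group
    by (auto simp: is_subgroup_U_def fixator_def mat_1_closed mult_closed cadj_closed Ad_matrix_mult_left)
qed

lemma in_lie_alg_fixator:
  assumes X: "X \<in> lie_alg K" and "\<And>Z. Z \<in> F \<Longrightarrow> ad X Z = 0"
  shows "X \<in> lie_alg (fixator K F)"
proof -
  have "Ad (mexp (t *\<^sub>R X)) Z = Z" if "Z \<in> F" for t Z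
  proof -
    have "ad (t *\<^sub>R X) Z = cscale 0 Z"
      using assms(2)[OF that] by (simp add: ad.scaleR_left cscale.zero_left)
    from Ad_mexp_eigvec[OF in_unitary_group[OF mexp_lie_alg[OF X]] this]
    show ?thesis by simp
  qed
  then show ?thesis using X by (auto simp: lie_alg_def fixator_def)
qed

lemma is_subgroup_U_line_stabilizer: "is_subgroup_U (line_stabilizer K A)"
proof -
  have "\<exists>d. Ad (cadj U) A = cscale d A" if "U \<in> K" "Ad U A = cscale c A" for U c
  proof -
    have A: "A = cscale c (Ad (cadj U) A)"
      using Ad_cadj_cancel(1)[OF in_unitary_group[OF that(1)], of A] that(2) by (simp add: Ad_cscale)
    show ?thesis
    proof (cases "c = 0")
      case True
      then have "A = 0" using A by (simp add: cscale.zero_left)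
      then show ?thesis by (simp add: cscale.zero_right)
    next
      case False
      then have "Ad (cadj U) A = cscale (inverse c) A"
        by (subst (2) A) (simp add: cscale_cscale)
      then show ?thesis by blast
    qed
  qed
  moreover have "\<exists>c. A = cscale c A" by (metis cscale_one)
  ultimately show ?thesis
    using in_unitary_group
    by (auto simp: is_subgroup_U_def line_stabilizer_def mat_1_closed mult_closed cadj_closed
        Ad_matrix_mult_left Ad_cscale cscale_cscale)
qed

lemma lie_alg_line_stabilizer_eigvec:
  assumes "X \<in> lie_alg (line_stabilizer K A)"
  shows "\<exists>c. ad X A = cscale c A"
proof -
  have "X \<in> lie_alg K"
    using assms lie_alg_mono[of "line_stabilizer K A" K] by (auto simp: line_stabilizer_def)
  moreover have "Ad (mexp (t *\<^sub>R X)) A \<in> range (\<lambda>c. cscale c A)" for t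
    using mexp_lie_alg[OF assms] by (auto simp: line_stabilizer_def)
  ultimately have "ad X A \<in> range (\<lambda>c. cscale c A)"
    by (intro subspace_has_vector_derivative[OF subspace_range_cscale _ Ad_mexp_lie_alg_has_vector_derivative])
  then show ?thesis by blast
qed

end

subsection \<open>Closed subgroups and their Lie algebras\<close>

lemma nat_floor_mult_tendsto:
  assumes e_pos: "\<And>n. 0 < e n" and e_lim: "e \<longlonglongrightarrow> 0" and "0 \<le> t"
  shows "(\<lambda>n. real (nat \<lfloor>t / e n\<rfloor>) * e n) \<longlonglongrightarrow> t"
proof -
  have "norm (real (nat \<lfloor>t / e n\<rfloor>) * e n - t) \<le> e n" for n
  proof -
    have "real (nat \<lfloor>t / e n\<rfloor>) = of_int \<lfloor>t / e n\<rfloor>" using e_pos[of n] \<open>0 \<le> t\<close> by simp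
    then have "real (nat \<lfloor>t / e n\<rfloor>) \<le> t / e n" "t / e n < real (nat \<lfloor>t / e n\<rfloor>) + 1" by linarith+
    then show ?thesis using e_pos[of n] by (simp add: field_simps)
  qed
  then have "(\<lambda>n. real (nat \<lfloor>t / e n\<rfloor>) * e n - t) \<longlonglongrightarrow> 0"
    by (intro Lim_null_comparison[OF _ e_lim] always_eventually) auto
  then show ?thesis by (rule LIM_zero_cancel)
qed

lemma direction_nearest_notin_lie_alg:
  assumes nearest: "\<And>n V. V \<in> H \<Longrightarrow> norm (h n - mat 1) \<le> norm (V ** h n - mat 1)"
    and "\<And>n. h n \<noteq> mat 1" and h_lim: "h \<longlonglongrightarrow> mat 1"
    and dir: "(\<lambda>n. (h n - mat 1) /\<^sub>R norm (h n - mat 1)) \<longlonglongrightarrow> Y"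
  shows "Y \<notin> lie_alg H"
proof
  assume Y: "Y \<in> lie_alg H"
  define e where "e n = norm (h n - mat 1)" for n
  have e_pos: "0 < e n" for n using assms(2) by (simp add: e_def)
  have e_lim: "e \<longlonglongrightarrow> 0"
    using h_lim by (simp add: e_def[abs_def] tendsto_norm_zero LIM_zero)
  let ?V = "\<lambda>n. mexp (e n *\<^sub>R (- Y))"
  have "1 \<le> norm ((?V n ** h n - mat 1) /\<^sub>R e n)" for n
  proof -
    have "?V n \<in> H" using mexp_lie_alg[OF Y, of "- e n"] by simp
    from nearest[OF this] show ?thesis using e_pos[of n] by (simp add: e_def divide_simps)
  qed
  moreover have "(\<lambda>n. (?V n ** h n - mat 1) /\<^sub>R e n) \<longlonglongrightarrow> 0"
  proof -
    have "(\<lambda>n. (?V n - mat 1) /\<^sub>R e n) \<longlonglongrightarrow> - Y"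
      using has_vector_derivative_imp_LIMSEQ[OF mexp_has_vector_derivative_0[of "- Y"] _ e_lim] e_pos
      by (simp add: less_imp_neq[THEN not_sym])
    then have "(\<lambda>n. (?V n - mat 1) /\<^sub>R e n ** h n + (h n - mat 1) /\<^sub>R e n) \<longlonglongrightarrow> - Y ** mat 1 + Y"
      using dir by (intro tendsto_add matrix_mult.tendsto h_lim) (simp_all add: e_def)
    then show ?thesis
      by (simp add: matrix_mult.scaleR_left matrix_mult.diff_left flip: scaleR_add_right)
  qed
  ultimately show False
    using Lim_bounded2[OF tendsto_norm, of _ 0 0 1] by fastforce
qed

locale compact_unitary_subgroup = unitary_subgroup +
  assumes compact: "compact K"
begin

lemma tangent_in_lie_alg:
  assumes h: "\<And>n. h n \<in> K" and e_pos: "\<And>n. 0 < e n" and e_lim: "e \<longlonglongrightarrow> 0"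
    and tangent: "(\<lambda>n. (h n - mat 1) /\<^sub>R e n) \<longlonglongrightarrow> Y"
  shows "Y \<in> lie_alg K"
proof -
  have nonneg: "mexp (t *\<^sub>R Y) \<in> K" if "0 \<le> t" for t
  proof (rule Lim_in_closed_set)
    show "(\<lambda>n. (((**) (h n)) ^^ nat \<lfloor>t / e n\<rfloor>) (mat 1)) \<longlonglongrightarrow> mexp (t *\<^sub>R Y)"
      by (rule matrix_power_tendsto_mexp[OF e_pos e_lim tangent nat_floor_mult_tendsto[OF e_pos e_lim that]])
  qed (simp_all add: compact compact_imp_closed h power_closed)
  have "mexp (t *\<^sub>R Y) \<in> K" if "t < 0" for t
  proof -
    let ?V = "mexp (- (t *\<^sub>R Y))"
    have V: "?V \<in> K" using nonneg[of "- t"] that by simp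
    have "mexp (t *\<^sub>R Y) = mexp (t *\<^sub>R Y) ** (?V ** cadj ?V)"
      by (simp add: unitary_groupD[OF in_unitary_group[OF V]])
    also have "\<dots> = cadj ?V"
      by (simp add: matrix_mul_assoc mexp_minus_inverse)
    finally show ?thesis using V by (simp add: cadj_closed)
  qed
  with nonneg show ?thesis by (force simp: lie_alg_def not_le)
qed

lemma has_vector_derivative_0_in_lie_alg:
  assumes "\<And>t. f t \<in> K" "f 0 = mat 1" "(f has_vector_derivative Y) (at 0)"
  shows "Y \<in> lie_alg K"
proof (rule tangent_in_lie_alg)
  let ?e = "\<lambda>n. inverse (real (Suc n))"
  show "(\<lambda>n. (f (?e n) - mat 1) /\<^sub>R ?e n) \<longlonglongrightarrow> Y"
    using has_vector_derivative_imp_LIMSEQ[OF assms(3) _ LIMSEQ_inverse_real_of_nat] assms(2) by simp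
qed (use assms LIMSEQ_inverse_real_of_nat in auto)

lemma subspace_lie_alg: "subspace (lie_alg K)"
proof (rule subspaceI)
  show "0 \<in> lie_alg K" by (simp add: lie_alg_def mat_1_closed)
  fix X Y assume X: "X \<in> lie_alg K" and Y: "Y \<in> lie_alg K"
  have "((\<lambda>t. mexp (t *\<^sub>R X) ** mexp (t *\<^sub>R Y)) has_vector_derivative X + Y) (at 0)"
    using matrix_mult.has_vector_derivative[OF mexp_has_vector_derivative_0[of X] mexp_has_vector_derivative_0[of Y]]
    by (simp add: add.commute)
  then show "X + Y \<in> lie_alg K"
    by (intro has_vector_derivative_0_in_lie_alg[of "\<lambda>t. mexp (t *\<^sub>R X) ** mexp (t *\<^sub>R Y)"])
      (simp_all add: mult_closed mexp_lie_alg X Y)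
qed (rule lie_alg_scaleR)

lemma ad_in_lie_alg:
  assumes "X \<in> lie_alg K" "Z \<in> lie_alg K"
  shows "ad X Z \<in> lie_alg K"
  using assms
  by (intro subspace_has_vector_derivative[OF subspace_lie_alg _ Ad_mexp_lie_alg_has_vector_derivative]
      Ad_in_lie_alg mexp_lie_alg)

lemma compact_unitary_subgroup_fixator: "compact_unitary_subgroup (fixator K F)"
proof unfold_locales
  have "closed {U. \<forall>Z\<in>F. Ad U Z = Z}"
    unfolding ball_simps Collect_ball_eq
    by (intro closed_INT ballI closed_Collect_eq continuous_on_Ad continuous_on_const)
  then have "compact (K \<inter> {U. \<forall>Z\<in>F. Ad U Z = Z})"
    by (rule compact_Int_closed[OF compact])
  then show "compact (fixator K F)" by (simp add: fixator_def Int_def)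
qed (rule is_subgroup_U_fixator)

lemma compact_unitary_subgroup_line_stabilizer: "compact_unitary_subgroup (line_stabilizer K A)"
proof unfold_locales
  have "closed ((\<lambda>U. Ad U A) -` range (\<lambda>c. cscale c A))"
    by (intro closed_vimage closed_subspace subspace_range_cscale continuous_on_Ad)
  then have "compact (K \<inter> (\<lambda>U. Ad U A) -` range (\<lambda>c. cscale c A))"
    by (rule compact_Int_closed[OF compact])
  moreover have "K \<inter> (\<lambda>U. Ad U A) -` range (\<lambda>c. cscale c A) = line_stabilizer K A"
    by (auto simp: line_stabilizer_def)
  ultimately show "compact (line_stabilizer K A)" by simp
qed (rule is_subgroup_U_line_stabilizer)

lemma lie_alg_limit_direction:
  assumes h: "\<And>n. h n \<in> K" "\<And>n. h n \<noteq> mat 1" "h \<longlonglongrightarrow> mat 1"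
  obtains r Y where "strict_mono r" "Y \<in> lie_alg K"
    "(\<lambda>n. (h (r n) - mat 1) /\<^sub>R norm (h (r n) - mat 1)) \<longlonglongrightarrow> Y"
proof -
  let ?dir = "\<lambda>n. (h n - mat 1) /\<^sub>R norm (h n - mat 1)"
  have "seq_compact (sphere 0 1 :: (complex^'n^'n) set)"
    by (simp flip: compact_eq_seq_compact_metric)
  moreover have "\<forall>n. ?dir n \<in> sphere 0 1" using h(2) by simp
  ultimately obtain Y r where r: "strict_mono r" and lim: "(?dir \<circ> r) \<longlonglongrightarrow> Y"
    by (rule seq_compactE)
  have "(\<lambda>n. norm (h n - mat 1)) \<longlonglongrightarrow> 0"
    using h(3) by (simp add: tendsto_norm_zero LIM_zero)
  from LIMSEQ_subseq_LIMSEQ[OF this r] have "(\<lambda>n. norm (h (r n) - mat 1)) \<longlonglongrightarrow> 0"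
    by (simp add: o_def)
  then have "Y \<in> lie_alg K"
    using lim h(1,2) by (intro tangent_in_lie_alg[of "h \<circ> r" "\<lambda>n. norm (h (r n) - mat 1)"]) (simp_all add: o_def)
  with r lim show ?thesis by (intro that) (simp_all add: o_def)
qed

lemma coset_representatives_nearest_mat_1:
  assumes g: "g \<in> K" and x: "x \<longlonglongrightarrow> g"
  obtains V where "\<And>n. V n \<in> K" "(\<lambda>n. V n ** x n) \<longlonglongrightarrow> mat 1"
    "\<And>n W. W \<in> K \<Longrightarrow> norm (V n ** x n - mat 1) \<le> norm (W ** (V n ** x n) - mat 1)"
proof -
  have "continuous_on K (\<lambda>V. norm (V ** x n - mat 1))" for n
    by (intro continuous_intros matrix_mult.continuous_on)
  then have "\<exists>V\<in>K. \<forall>W\<in>K. norm (V ** x n - mat 1) \<le> norm (W ** x n - mat 1)" for n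
    using compact mat_1_closed by (intro continuous_attains_inf) auto
  then obtain V where V: "\<And>n. V n \<in> K"
    and nearest: "\<And>n W. W \<in> K \<Longrightarrow> norm (V n ** x n - mat 1) \<le> norm (W ** x n - mat 1)"
    by metis
  have "norm (V n ** x n - mat 1) \<le> norm (x n - g)" for n
  proof -
    have "norm (V n ** x n - mat 1) \<le> norm (cadj g ** x n - mat 1)"
      by (intro nearest cadj_closed g)
    also have "cadj g ** x n - mat 1 = cadj g ** (x n - g)"
      by (simp add: matrix_mult.diff_right unitary_groupD[OF in_unitary_group[OF g]])
    also have "norm \<dots> = norm (x n - g)"
      by (intro norm_unitary_mult in_unitary_group cadj_closed g)
    finally show ?thesis .
  qed
  then have "(\<lambda>n. V n ** x n - mat 1) \<longlonglongrightarrow> 0"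
    by (intro Lim_null_comparison[OF _ tendsto_norm_zero[OF LIM_zero[OF x]]] always_eventually allI)
  then have "(\<lambda>n. V n ** x n) \<longlonglongrightarrow> mat 1" by (rule LIM_zero_cancel)
  moreover have "norm (V n ** x n - mat 1) \<le> norm (W ** (V n ** x n) - mat 1)" if "W \<in> K" for n W
    using nearest[OF mult_closed[OF that V]] by (simp add: matrix_mul_assoc)
  ultimately show ?thesis by (rule that[OF V])
qed

lemma openin_subgroup_if_lie_alg_subset:
  assumes H: "compact_unitary_subgroup H" "H \<subseteq> K" and lie: "lie_alg K \<subseteq> lie_alg H"
  shows "openin (top_of_set K) H"
proof (rule ccontr)
  interpret H: compact_unitary_subgroup H by fact
  assume "\<not> openin (top_of_set K) H"
  then obtain g where g: "g \<in> H" and near: "\<And>d. 0 < d \<Longrightarrow> \<exists>x\<in>K. dist x g < d \<and> x \<notin> H"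
    using H(2) unfolding openin_euclidean_subtopology_iff by blast
  have "g \<in> closure (K - H)"
    unfolding closure_approachable using near by blast
  then obtain x where x: "\<And>n. x n \<in> K" "\<And>n. x n \<notin> H" and x_lim: "x \<longlonglongrightarrow> g"
    unfolding closure_sequential by blast
  obtain V where V: "\<And>n. V n \<in> H" and lim: "(\<lambda>n. V n ** x n) \<longlonglongrightarrow> mat 1"
    and nearest: "\<And>n W. W \<in> H \<Longrightarrow> norm (V n ** x n - mat 1) \<le> norm (W ** (V n ** x n) - mat 1)"
    by (rule H.coset_representatives_nearest_mat_1[OF g x_lim]) (rule that)
  have in_K: "V n ** x n \<in> K" for n
    using V H(2) x(1) by (blast intro: mult_closed)
  have ne_1: "V n ** x n \<noteq> mat 1" for n
  proof
    assume "V n ** x n = mat 1"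
    then have "x n = cadj (V n)"
      by (metis H.in_unitary_group V matrix_mul_assoc matrix_mul_lid matrix_mul_rid unitary_groupD(2))
    then show False using H.cadj_closed[OF V] x(2) by metis
  qed
  obtain r Y where r: "strict_mono r" and Y: "Y \<in> lie_alg K"
    and dir: "(\<lambda>n. (V (r n) ** x (r n) - mat 1) /\<^sub>R norm (V (r n) ** x (r n) - mat 1)) \<longlonglongrightarrow> Y"
    using lie_alg_limit_direction[OF in_K ne_1 lim] .
  have "(\<lambda>n. V (r n) ** x (r n)) \<longlonglongrightarrow> mat 1"
    using LIMSEQ_subseq_LIMSEQ[OF lim r] by (simp add: o_def)
  from direction_nearest_notin_lie_alg[OF nearest ne_1 this dir] show False
    using Y lie by blast
qed

end

subsection \<open>Conjugation into a torus algebra\<close>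

lemma span_commuting:
  assumes commuting: "\<And>X Y. X \<in> S \<Longrightarrow> Y \<in> S' \<Longrightarrow> ad X Y = 0" and "X \<in> span S" "Y \<in> span S'"
  shows "ad X Y = 0"
proof -
  have subspace: "subspace {Y. ad X Y = 0}" for X
    by (auto simp: subspace_def ad.zero_right ad.add_right ad.scaleR_right)
  have "ad X Y = 0" if "X \<in> S" for X
    using span_minimal[OF _ subspace, of S' X] commuting[OF that] \<open>Y \<in> span S'\<close> by blast
  then have "S \<subseteq> {X. ad Y X = 0}" by (auto simp: ad_commute[of Y])
  from span_minimal[OF this subspace] have "ad Y X = 0" using \<open>X \<in> span S\<close> by blast
  then show ?thesis by (simp add: ad_commute[of X])
qed

lemma torus_algebra_mem_if_commuting:
  assumes T: "torus_algebra L T" and L: "subspace L" and "W \<in> L" and W: "\<And>Z. Z \<in> T \<Longrightarrow> ad W Z = 0"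
  shows "W \<in> T"
proof -
  have "abelian_subalg L T" and maximal: "\<And>T'. abelian_subalg L T' \<Longrightarrow> T \<subseteq> T' \<Longrightarrow> T' = T"
    using T by (auto simp: torus_algebra_def)
  then have TL: "T \<subseteq> L" and T_commuting: "\<And>X Y. X \<in> T \<Longrightarrow> Y \<in> T \<Longrightarrow> ad X Y = 0"
    by (auto simp: abelian_subalg_def ad_eq_0_iff)
  have insert_commuting: "ad X Y = 0" if "X \<in> insert W T" "Y \<in> insert W T" for X Y
    using that T_commuting W by (auto simp: ad_eq_0_iff)
  have "ad X Y = 0" if "X \<in> span (insert W T)" "Y \<in> span (insert W T)" for X Y
    using span_commuting[OF insert_commuting that] .
  moreover have "span (insert W T) \<subseteq> L"
    using TL \<open>W \<in> L\<close> L by (intro span_minimal) auto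
  ultimately have "abelian_subalg L (span (insert W T))"
    by (simp add: abelian_subalg_def ad_eq_0_iff)
  then have "span (insert W T) = T"
    by (rule maximal) (auto intro: span_base)
  then show ?thesis using span_base[of W "insert W T"] by simp
qed

context compact_unitary_subgroup
begin

lemma exists_Ad_commuting:
  assumes X: "X \<in> lie_alg K" and Z: "Z \<in> lie_alg K"
  shows "\<exists>U\<in>K. ad (Ad U X) Z = 0"
proof -
  have "continuous_on K (\<lambda>U. Ad U X \<bullet> Z)"
    by (intro continuous_on_inner continuous_on_Ad continuous_on_const)
  then obtain U where U: "U \<in> K" and max: "\<And>V. V \<in> K \<Longrightarrow> Ad V X \<bullet> Z \<le> Ad U X \<bullet> Z"
    using continuous_attains_sup[OF compact] mat_1_closed by blast
  define W where "W = Ad U X"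
  define Y where "Y = ad W Z"
  have W: "W \<in> lie_alg K" unfolding W_def using Ad_in_lie_alg[OF U X] .
  then have Y: "Y \<in> lie_alg K" unfolding Y_def using ad_in_lie_alg Z by blast
  have "((\<lambda>t. Ad (mexp (t *\<^sub>R Y)) W \<bullet> Z) has_real_derivative ad Y W \<bullet> Z) (at 0)"
    unfolding has_real_derivative_iff_has_vector_derivative
    by (intro bounded_linear.has_vector_derivative[OF bounded_linear_inner_left]
        Ad_mexp_lie_alg_has_vector_derivative Y)
  moreover have "Ad (mexp (t *\<^sub>R Y)) W \<bullet> Z \<le> W \<bullet> Z" for t
    using max[OF mult_closed[OF mexp_lie_alg[OF Y] U]] by (simp add: W_def Ad_matrix_mult_left)
  ultimately have "ad Y W \<bullet> Z = 0"
    by (intro DERIV_local_max[where x = 0 and d = 1]) auto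
  moreover have "ad Y W \<bullet> Z = Y \<bullet> Y"
    using inner_ad_skew[OF cadj_lie_alg[OF W], of Y Z] by (simp add: ad_commute[of Y W] flip: Y_def)
  ultimately have "Y = 0" by simp
  then show ?thesis using U by (auto simp: Y_def W_def)
qed

lemma exists_Ad_commuting_finite:
  assumes X: "X \<in> lie_alg K"
    and "finite F" "F \<subseteq> lie_alg K" "\<And>Y Z. Y \<in> F \<Longrightarrow> Z \<in> F \<Longrightarrow> ad Y Z = 0"
  shows "\<exists>U\<in>K. \<forall>Z\<in>F. ad (Ad U X) Z = 0"
  using assms(2-)
proof (induction F rule: finite_induct)
  case empty
  then show ?case using mat_1_closed by auto
next
  case (insert Z F)
  then obtain U where U: "U \<in> K" and U_comm: "\<And>Y. Y \<in> F \<Longrightarrow> ad (Ad U X) Y = 0"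
    by auto
  interpret fixator: compact_unitary_subgroup "fixator K F"
    by (rule compact_unitary_subgroup_fixator)
  have "Ad U X \<in> lie_alg (fixator K F)" "Z \<in> lie_alg (fixator K F)"
    using U_comm insert.prems by (auto intro!: in_lie_alg_fixator Ad_in_lie_alg[OF U X])
  then obtain V where V: "V \<in> fixator K F" and "ad (Ad V (Ad U X)) Z = 0"
    using fixator.exists_Ad_commuting by blast
  moreover have "ad (Ad V (Ad U X)) Y = 0" if "Y \<in> F" for Y
  proof -
    have "ad (Ad V (Ad U X)) (Ad V Y) = 0"
      by (simp add: ad_Ad fixator.in_unitary_group V U_comm that)
    then show ?thesis using V that by (simp add: fixator_def)
  qed
  moreover have "V ** U \<in> K" using V U by (simp add: fixator_def mult_closed)
  ultimately show ?case
    by (intro bexI[of _ "V ** U"]) (auto simp: Ad_matrix_mult_left)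
qed

lemma exists_Ad_in_torus_algebra:
  assumes T: "torus_algebra (lie_alg K) T" and X: "X \<in> lie_alg K"
  shows "\<exists>U\<in>K. Ad U X \<in> T"
proof -
  have "T \<subseteq> lie_alg K" "subspace T" and T_commuting: "\<And>Y Z. Y \<in> T \<Longrightarrow> Z \<in> T \<Longrightarrow> ad Y Z = 0"
    using T by (auto simp: torus_algebra_def abelian_subalg_def ad_eq_0_iff)
  obtain B where B: "finite B" "B \<subseteq> T" "span B = T"
    using basis_subspace_exists[OF \<open>subspace T\<close>] by metis
  have "\<exists>U\<in>K. \<forall>Z\<in>B. ad (Ad U X) Z = 0"
    using B(1,2) \<open>T \<subseteq> lie_alg K\<close>
    by (intro exists_Ad_commuting_finite X) (auto intro: T_commuting)
  then obtain U where U: "U \<in> K" and "\<And>Z. Z \<in> B \<Longrightarrow> ad (Ad U X) Z = 0"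
    by blast
  then have "ad (Ad U X) Z = 0" if "Z \<in> T" for Z
    using span_commuting[of "{Ad U X}" B] that B(3) span_base by blast
  then have "Ad U X \<in> T"
    by (intro torus_algebra_mem_if_commuting[OF T subspace_lie_alg] Ad_in_lie_alg U X)
  with U show ?thesis by blast
qed

end

subsection \<open>Rotational symmetry\<close>

lemma orbit_eq_image_Ad: "orbit K A = (\<lambda>U. Ad U A) ` K"
  by (auto simp: orbit_def Ad_def)

context unitary_subgroup
begin

lemma weakly_rot_sym_iff: "weakly_rot_sym K A \<longleftrightarrow> (\<forall>\<phi>. \<exists>U\<in>K. Ad U A = cscale (cis \<phi>) A)"
proof
  assume "weakly_rot_sym K A"
  moreover have "A \<in> orbit K A"
    using mat_1_closed by (auto simp: orbit_eq_image_Ad intro: rev_image_eqI)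
  ultimately have "cscale (cis \<phi>) A \<in> orbit K A" for \<phi>
    by (auto simp: weakly_rot_sym_def)
  then show "\<forall>\<phi>. \<exists>U\<in>K. Ad U A = cscale (cis \<phi>) A"
    by (auto simp: orbit_eq_image_Ad image_iff eq_commute)
next
  assume rotation: "\<forall>\<phi>. \<exists>U\<in>K. Ad U A = cscale (cis \<phi>) A"
  have rotate: "cscale (cis \<phi>) B \<in> orbit K A" if "B \<in> orbit K A" for B \<phi>
  proof -
    obtain U where U: "U \<in> K" "B = Ad U A" using \<open>B \<in> orbit K A\<close> by (auto simp: orbit_eq_image_Ad)
    obtain V where V: "V \<in> K" "Ad V A = cscale (cis \<phi>) A" using rotation by blast
    have "cscale (cis \<phi>) B = Ad (U ** V) A" by (simp add: U V Ad_matrix_mult_left Ad_cscale)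
    then show ?thesis using U V by (auto simp: orbit_eq_image_Ad mult_closed)
  qed
  have "B \<in> cscale (cis \<phi>) ` orbit K A" if "B \<in> orbit K A" for B \<phi>
    by (rule image_eqI[OF _ rotate[OF that, of "- \<phi>"]]) (simp add: cscale_cscale cis_mult)
  with rotate show "weakly_rot_sym K A" by (auto simp: weakly_rot_sym_def)
qed

lemma weakly_rot_sym_if_ad_eigvec:
  assumes \<Omega>: "\<Omega> \<in> lie_alg K" and "ad_eigvec_nonzero \<Omega> A"
  shows "weakly_rot_sym K A"
proof -
  obtain c where c: "ad \<Omega> A = cscale c A" "c \<noteq> 0" and "A \<noteq> 0"
    using assms(2) by (auto simp: ad_eigvec_nonzero_def)
  have "ad \<Omega> A \<bullet> A = - (ad \<Omega> A \<bullet> A)"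
    using inner_ad_skew[OF cadj_lie_alg[OF \<Omega>], of A A] by (simp add: inner_commute)
  then have "Re c = 0" using \<open>A \<noteq> 0\<close> by (simp add: c inner_cscale_self)
  then have "Im c \<noteq> 0" using \<open>c \<noteq> 0\<close> by (simp add: complex_eq_iff)
  have "Ad (mexp ((\<phi> / Im c) *\<^sub>R \<Omega>)) A = cscale (cis \<phi>) A" for \<phi>
  proof -
    have "(\<phi> / Im c) *\<^sub>R c = \<i> * of_real \<phi>"
      using \<open>Re c = 0\<close> \<open>Im c \<noteq> 0\<close> by (simp add: complex_eq_iff)
    then have "ad ((\<phi> / Im c) *\<^sub>R \<Omega>) A = cscale (\<i> * of_real \<phi>) A"
      by (metis ad.scaleR_left c(1) cscale.scaleR_left)
    then show ?thesis
      by (simp add: Ad_mexp_eigvec in_unitary_group mexp_lie_alg \<Omega> cis_conv_exp)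
  qed
  then show ?thesis
    using mexp_lie_alg[OF \<Omega>] by (auto simp: weakly_rot_sym_iff)
qed

end

context compact_unitary_subgroup
begin

lemma not_openin_fixator_if_weakly_rot_sym:
  assumes "A \<noteq> 0" and sym: "weakly_rot_sym K A"
  shows "\<not> openin (top_of_set (line_stabilizer K A)) (fixator K {A})"
proof
  let ?G = "line_stabilizer K A" and ?H = "fixator K {A}"
  interpret G: compact_unitary_subgroup ?G by (rule compact_unitary_subgroup_line_stabilizer)
  assume "openin (top_of_set ?G) ?H"
  then have "closedin (top_of_set ?G) (?G - ?H)"
    by (intro closedin_diff) auto
  then have "closed ((\<lambda>U. Ad U A) ` (?G - ?H))"
    by (intro compact_imp_closed compact_continuous_image continuous_on_Ad closedin_compact[OF G.compact])
  moreover have "((\<lambda>\<phi>. cscale (cis \<phi>) A) \<longlongrightarrow> cscale (cis 0) A) (at_right 0)"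
    by (intro cscale.tendsto tendsto_cis tendsto_ident_at tendsto_const)
  moreover have "\<forall>\<^sub>F \<phi> in at_right 0. cscale (cis \<phi>) A \<in> (\<lambda>U. Ad U A) ` (?G - ?H)"
  proof (rule eventually_at_rightI[of 0 pi])
    fix \<phi> :: real assume "\<phi> \<in> {0<..<pi}"
    then have "sin \<phi> \<noteq> 0" using sin_gt_zero[of \<phi>] by simp
    then have "cscale (cis \<phi>) A \<noteq> A"
      using \<open>A \<noteq> 0\<close> by (auto simp: cscale_eq_self_iff complex_eq_iff)
    moreover obtain U where "U \<in> K" "Ad U A = cscale (cis \<phi>) A"
      using sym by (auto simp: weakly_rot_sym_iff)
    ultimately show "cscale (cis \<phi>) A \<in> (\<lambda>U. Ad U A) ` (?G - ?H)"
      by (intro image_eqI[of _ _ U]) (auto simp: line_stabilizer_def fixator_def)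
  qed simp
  ultimately have "cscale (cis 0) A \<in> (\<lambda>U. Ad U A) ` (?G - ?H)"
    by (intro Lim_in_closed_set) auto
  then show False by (auto simp: line_stabilizer_def fixator_def)
qed

lemma ad_eigvec_if_weakly_rot_sym:
  assumes "A \<noteq> 0" and "weakly_rot_sym K A"
  shows "\<exists>\<Omega>\<in>lie_alg K. ad_eigvec_nonzero \<Omega> A"
proof -
  let ?G = "line_stabilizer K A" and ?H = "fixator K {A}"
  interpret G: compact_unitary_subgroup ?G by (rule compact_unitary_subgroup_line_stabilizer)
  have "?H \<subseteq> ?G"
    by (auto simp: fixator_def line_stabilizer_def intro: exI[of _ 1])
  then obtain \<Omega> where \<Omega>: "\<Omega> \<in> lie_alg ?G" "\<Omega> \<notin> lie_alg ?H"
    using G.openin_subgroup_if_lie_alg_subset[OF compact_unitary_subgroup_fixator]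
      not_openin_fixator_if_weakly_rot_sym[OF assms] by blast
  then have "\<Omega> \<in> lie_alg K"
    using lie_alg_mono[of ?G K] by (auto simp: line_stabilizer_def)
  moreover obtain c where "ad \<Omega> A = cscale c A"
    using lie_alg_line_stabilizer_eigvec[OF \<Omega>(1)] by blast
  moreover have "ad \<Omega> A \<noteq> 0"
    using in_lie_alg_fixator[OF \<open>\<Omega> \<in> lie_alg K\<close>, of "{A}"] \<Omega>(2) by blast
  ultimately show ?thesis
    using \<open>A \<noteq> 0\<close> by (force simp: ad_eigvec_nonzero_def cscale_eq_0_iff)
qed

lemma ad_eigvec_lie_alg_iff_torus_algebra:
  assumes T: "torus_algebra (lie_alg K) T"
  shows "(\<exists>\<Omega>\<in>lie_alg K. ad_eigvec_nonzero \<Omega> A)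
    \<longleftrightarrow> (\<exists>U\<in>K. \<exists>\<Delta>\<in>T. ad_eigvec_nonzero \<Delta> (Ad U A))"
proof safe
  fix \<Omega> assume "\<Omega> \<in> lie_alg K" "ad_eigvec_nonzero \<Omega> A"
  moreover obtain U where "U \<in> K" "Ad U \<Omega> \<in> T"
    using exists_Ad_in_torus_algebra[OF T \<open>\<Omega> \<in> lie_alg K\<close>] by blast
  ultimately show "\<exists>U\<in>K. \<exists>\<Delta>\<in>T. ad_eigvec_nonzero \<Delta> (Ad U A)"
    using ad_eigvec_nonzero_Ad in_unitary_group by blast
next
  fix U \<Delta> assume U: "U \<in> K" and \<Delta>: "\<Delta> \<in> T" "ad_eigvec_nonzero \<Delta> (Ad U A)"
  have "\<Delta> \<in> lie_alg K"
    using \<Delta>(1) T by (auto simp: torus_algebra_def abelian_subalg_def)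
  then have "Ad (cadj U) \<Delta> \<in> lie_alg K" by (intro Ad_in_lie_alg cadj_closed U)
  moreover have "ad_eigvec_nonzero (Ad (cadj U) \<Delta>) A"
    using \<Delta>(2) ad_eigvec_nonzero_Ad[of U "Ad (cadj U) \<Delta>" A] in_unitary_group[OF U] by simp
  ultimately show "\<exists>\<Omega>\<in>lie_alg K. ad_eigvec_nonzero \<Omega> A" by blast
qed

end

theorem theorem2p15:
  fixes K :: "(complex^'n^'n) set" and T :: "(complex^'n^'n) set" and A :: "complex^'n^'n"
  assumes "is_subgroup_U K" and "compact K" and "connected K"
    and "torus_algebra (lie_alg K) T"
    and "A \<noteq> 0"
  shows "(weakly_rot_sym K A \<longleftrightarrow> (\<exists>\<Omega>\<in>lie_alg K. ad_eigvec_nonzero \<Omega> A))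
       \<and> (weakly_rot_sym K A \<longleftrightarrow>
           (\<exists>U\<in>K. \<exists>\<Delta>\<in>T. ad_eigvec_nonzero \<Delta> (U ** A ** cadj U)))"
proof -
  interpret compact_unitary_subgroup K
    using assms(1,2) by unfold_locales
  have "weakly_rot_sym K A \<longleftrightarrow> (\<exists>\<Omega>\<in>lie_alg K. ad_eigvec_nonzero \<Omega> A)"
    using ad_eigvec_if_weakly_rot_sym[OF \<open>A \<noteq> 0\<close>] weakly_rot_sym_if_ad_eigvec by blast
  with ad_eigvec_lie_alg_iff_torus_algebra[OF assms(4)] show ?thesis
    by (simp add: Ad_def)
qed

end
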